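(* Let $H$ be a proper subgroup of the finite group $K$, let $x\in K$ with $x^2\in H$, let $S=H\cup\{x,x^{-1}\}$, let $L=H\cap x^{-1}Hx$, and set $T=H\cup xL$. Then $|T|\ge|S|$ but $T^3=S^3$.
   Context: For a subset $S$ of a group, $S^3=\{abc: a,b,c\in S\}$. *)

theory Defs
  imports "HOL-Algebra.Coset"
begin

definition set_cube :: "('a, 'b) monoid_scheme \<Rightarrow> 'a set \<Rightarrow> 'a set" where
  "set_cube G S = {a \<otimes>\<^bsub>G\<^esub> b \<otimes>\<^bsub>G\<^esub> c | a b c. a \<in> S \<and> b \<in> S \<and> c \<in> S}"

end

theory Submission
  imports Defs
begin

text \<open>
  The set \<open>xL\<close> is the intersection \<open>D\<close> of the cosets \<open>xH\<close> and \<open>Hx\<close>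
  (lemma \<open>l_coset_Int_conjugate\<close>). Since \<open>x\<^sup>2 \<in> H\<close>, both \<open>x\<close> and its inverse lie in \<open>D\<close>;
  hence \<open>S \<subseteq> T\<close>, which gives the inequality of cardinalities and one of the two inclusions of
  cubes. For the other one, an element of \<open>D\<close> can be written with \<open>x\<close> on whichever side is
  convenient. A product of two of them is therefore in \<open>(Hx)(xH) = H\<close>, because \<open>x\<^sup>2 \<in> H\<close>.
  It follows that a product of three elements of \<open>T = H \<union> D\<close> lies in \<open>H\<close>, in \<open>HxH\<close> or in \<open>xHx\<close>:
  two adjacent factors in \<open>D\<close> merge into one in \<open>H\<close>, and the only pattern with two
  non-adjacent such factors, \<open>DHD\<close>, lies in \<open>(xH)H(Hx) = xHx\<close>. These three sets are contained in
  the cube of \<open>H \<union> {x}\<close>.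
\<close>

text \<open>
  Left translation by \<open>x\<close> takes the conjugate of \<open>H\<close> by \<open>x\<close> to the right coset \<open>Hx\<close>.
\<close>

lemma (in group) l_coset_Int_conjugate:
  assumes H: "subgroup H G" and x: "x \<in> carrier G"
  shows "x <# (H \<inter> ((inv x <# H) #> x)) = (x <# H) \<inter> (H #> x)"
proof -
  have HG: "h \<in> carrier G" if "h \<in> H" for h
    using subgroup.mem_carrier[OF H that] .
  have shift: "x \<otimes> (inv x \<otimes> h \<otimes> x) = h \<otimes> x" if "h \<in> H" for h
    using x HG[OF that] by (simp add: m_assoc[symmetric])
  show ?thesis
  proof (intro equalityI subsetI)
    fix y assume "y \<in> x <# (H \<inter> ((inv x <# H) #> x))"
    then obtain l h where "l \<in> H" "h \<in> H" "l = inv x \<otimes> h \<otimes> x" "y = x \<otimes> l"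
      by (auto simp: l_coset_def r_coset_def)
    then show "y \<in> (x <# H) \<inter> (H #> x)"
      using shift unfolding l_coset_def r_coset_def by blast
  next
    fix y assume "y \<in> (x <# H) \<inter> (H #> x)"
    then obtain l h where lh: "l \<in> H" "h \<in> H" "y = x \<otimes> l" "y = h \<otimes> x"
      by (auto simp: l_coset_def r_coset_def)
    then have "x \<otimes> l = x \<otimes> (inv x \<otimes> h \<otimes> x)"
      using shift by simp
    then have "l = inv x \<otimes> h \<otimes> x"
      using x lh HG by simp
    with lh show "y \<in> x <# (H \<inter> ((inv x <# H) #> x))"
      by (auto simp: l_coset_def r_coset_def)
  qed
qed

lemma set_cubeI:
  assumes "a \<in> S" "b \<in> S" "c \<in> S"
  shows "a \<otimes>\<^bsub>G\<^esub> b \<otimes>\<^bsub>G\<^esub> c \<in> set_cube G S"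
  using assms by (auto simp: set_cube_def)

lemma set_cube_mono:
  assumes "S \<subseteq> T"
  shows "set_cube G S \<subseteq> set_cube G T"
  using assms by (auto simp: set_cube_def)

text \<open>
  Replacing \<open>x\<close> by the whole of \<open>xH \<inter> Hx\<close> adds nothing to the cube, since each element of this
  intersection behaves like \<open>x\<close> up to a factor in \<open>H\<close> on either side.
\<close>

lemma (in group) set_cube_Un_two_sided_coset:
  assumes H: "subgroup H G" and x: "x \<in> carrier G" and sq: "x \<otimes> x \<in> H"
  shows "set_cube G (H \<union> ((x <# H) \<inter> (H #> x))) \<subseteq> set_cube G (insert x H)"
proof -
  define D where "D = (x <# H) \<inter> (H #> x)"
  let ?C = "set_cube G (insert x H)"
  note mult = subgroup.m_closed[OF H]
  have HG: "h \<in> carrier G" if "h \<in> H" for h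
    using subgroup.mem_carrier[OF H that] .
  have right: "\<exists>h\<in>H. d = x \<otimes> h" and left: "\<exists>h\<in>H. d = h \<otimes> x" if "d \<in> D" for d
    using that by (auto simp: D_def l_coset_def r_coset_def)
  have DG: "d \<in> carrier G" if "d \<in> D" for d
    using left[OF that] x HG by auto
  have DD: "d \<otimes> e \<in> H" if de: "d \<in> D" "e \<in> D" for d e
  proof -
    obtain h k where hk: "h \<in> H" "k \<in> H" "d = h \<otimes> x" "e = x \<otimes> k"
      using left[OF de(1)] right[OF de(2)] by auto
    then have "d \<otimes> e = h \<otimes> (x \<otimes> x) \<otimes> k"
      using x HG by (simp add: m_assoc)
    then show ?thesis
      using mult[OF mult[OF hk(1) sq] hk(2)] by simp
  qed
  have H_C: "h \<in> ?C" if "h \<in> H" for h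
    using set_cubeI[of h "insert x H" \<one> \<one> G] that HG subgroup.one_closed[OF H] by simp
  have HxH_C: "h \<otimes> x \<otimes> k \<in> ?C" if "h \<in> H" "k \<in> H" for h k
    using that by (auto intro: set_cubeI)
  have HDH_C: "h \<otimes> d \<otimes> k \<in> ?C" if hk: "h \<in> H" "k \<in> H" and d: "d \<in> D" for h d k
  proof -
    obtain l where l: "l \<in> H" "d = l \<otimes> x"
      using left[OF d] by auto
    then have "h \<otimes> d \<otimes> k = (h \<otimes> l) \<otimes> x \<otimes> k"
      using x hk HG by (simp add: m_assoc)
    then show ?thesis
      using HxH_C[OF mult[OF hk(1) l(1)] hk(2)] by simp
  qed
  have HD_C: "h \<otimes> d \<in> ?C" if "h \<in> H" "d \<in> D" for h d
    using HDH_C[of h \<one> d] that HG DG subgroup.one_closed[OF H] by simp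
  have DH_C: "d \<otimes> h \<in> ?C" if "h \<in> H" "d \<in> D" for h d
    using HDH_C[of \<one> h d] that HG DG subgroup.one_closed[OF H] by simp
  have DHD_C: "d \<otimes> h \<otimes> e \<in> ?C" if h: "h \<in> H" and de: "d \<in> D" "e \<in> D" for h d e
  proof -
    obtain k l where kl: "k \<in> H" "l \<in> H" "d = x \<otimes> k" "e = l \<otimes> x"
      using right[OF de(1)] left[OF de(2)] by auto
    then have "d \<otimes> h \<otimes> e = x \<otimes> (k \<otimes> h \<otimes> l) \<otimes> x"
      using x h HG by (simp add: m_assoc)
    then show ?thesis
      using mult[OF mult[OF kl(1) h] kl(2)] by (auto intro: set_cubeI)
  qed
  have "a \<otimes> b \<otimes> c \<in> ?C" if abc: "a \<in> H \<union> D" "b \<in> H \<union> D" "c \<in> H \<union> D" for a b c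
  proof -
    have G: "a \<in> carrier G" "b \<in> carrier G" "c \<in> carrier G"
      using abc HG DG by auto
    note assoc = m_assoc[OF G]
    consider
        "a \<in> H" "b \<in> H" "c \<in> H" | "a \<in> H" "b \<in> H" "c \<in> D"
      | "a \<in> H" "b \<in> D" "c \<in> H" | "a \<in> H" "b \<in> D" "c \<in> D"
      | "a \<in> D" "b \<in> H" "c \<in> H" | "a \<in> D" "b \<in> H" "c \<in> D"
      | "a \<in> D" "b \<in> D" "c \<in> H" | "a \<in> D" "b \<in> D" "c \<in> D"
      using abc by blast
    then show ?thesis
    proof cases
      case 1 then show ?thesis by (intro H_C mult)
    next
      case 2 then show ?thesis by (intro HD_C mult)
    next
      case 3 then show ?thesis by (intro HDH_C)
    next
      case 4 then show ?thesis unfolding assoc by (intro H_C mult DD)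
    next
      case 5 then show ?thesis unfolding assoc by (intro DH_C mult)
    next
      case 6 then show ?thesis by (intro DHD_C)
    next
      case 7 then show ?thesis by (intro H_C mult DD)
    next
      case 8 then show ?thesis by (intro HD_C DD)
    qed
  qed
  then show ?thesis
    by (auto simp: set_cube_def D_def[symmetric])
qed

theorem proposition3p2:
  fixes K :: "('a, 'b) monoid_scheme" and H S L T :: "'a set" and x :: 'a
  assumes "group K" and "finite (carrier K)"
    and "subgroup H K" and "H \<noteq> carrier K"
    and "x \<in> carrier K" and "x [^]\<^bsub>K\<^esub> (2::nat) \<in> H"
    and "S = H \<union> {x, inv\<^bsub>K\<^esub> x}"
    and "L = H \<inter> ((inv\<^bsub>K\<^esub> x <#\<^bsub>K\<^esub> H) #>\<^bsub>K\<^esub> x)"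
    and "T = H \<union> (x <#\<^bsub>K\<^esub> L)"
  shows "card T \<ge> card S \<and> set_cube K T = set_cube K S"
proof -
  interpret group K by fact
  note H = \<open>subgroup H K\<close> and x = \<open>x \<in> carrier K\<close>
  have HG: "H \<subseteq> carrier K"
    using subgroup.subset[OF H] .
  have sq: "x \<otimes>\<^bsub>K\<^esub> x \<in> H"
    using assms(6) x by (simp add: numeral_2_eq_2)
  have T: "T = H \<union> ((x <#\<^bsub>K\<^esub> H) \<inter> (H #>\<^bsub>K\<^esub> x))"
    using assms(8,9) l_coset_Int_conjugate[OF H x] by simp
  have "x \<in> T"
  proof -
    have "x = x \<otimes>\<^bsub>K\<^esub> \<one>\<^bsub>K\<^esub>" "x = \<one>\<^bsub>K\<^esub> \<otimes>\<^bsub>K\<^esub> x"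
      using x by simp_all
    then show ?thesis
      using subgroup.one_closed[OF H] unfolding T l_coset_def r_coset_def by blast
  qed
  moreover have "inv\<^bsub>K\<^esub> x \<in> T"
  proof -
    let ?k = "inv\<^bsub>K\<^esub> (x \<otimes>\<^bsub>K\<^esub> x)"
    have "?k \<in> H"
      using subgroup.m_inv_closed[OF H sq] .
    moreover have "inv\<^bsub>K\<^esub> x = x \<otimes>\<^bsub>K\<^esub> ?k" "inv\<^bsub>K\<^esub> x = ?k \<otimes>\<^bsub>K\<^esub> x"
      using x by (simp_all add: inv_mult_group m_assoc m_assoc[of x "inv\<^bsub>K\<^esub> x", symmetric])
    ultimately show ?thesis
      unfolding T l_coset_def r_coset_def by blast
  qed
  ultimately have ST: "S \<subseteq> T"
    using assms(7) T by auto
  have "T \<subseteq> carrier K"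
    using HG r_coset_subset_G[OF HG x] T by auto
  then have "finite T"
    using \<open>finite (carrier K)\<close> finite_subset by blast
  then have "card S \<le> card T"
    using ST by (rule card_mono)
  moreover have "set_cube K T \<subseteq> set_cube K S"
    using set_cube_Un_two_sided_coset[OF H x sq] set_cube_mono[of "insert x H" S K] assms(7) T
    by auto
  ultimately show ?thesis
    using set_cube_mono[OF ST] by blast
qed

end
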